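(* Let $K(a_{n,k})$ be a Köthe space, let $\Lambda_1(\beta)$ be a power series space of finite type, let $\theta=(\theta_t)_{t\ge 0}$ be a scalar sequence and $s_0=\min\{t:\theta_t\neq 0\}$. Then $\hat T_\theta:K(a_{n,k})\to\Lambda_1(\beta)$ is compact if and only if $\theta\in\Lambda_1(\beta)$ and $$\exists m\in\mathbb{N}\ \forall k\in\mathbb{N}\ \exists C>0\ \ \forall n\in\mathbb{N}:\quad e^{-\frac1k\beta_{n+s_0}}\le C a_{n,m}.$$
   Context: $\mathbb{N}=\{1,2,3,\dots\}$. A Köthe matrix is a matrix $(a_{n,k})_{n,k\in\mathbb{N}}$ of non-negative numbers such that for each $n$ there is $k$ with $a_{n,k}>0$, and $a_{n,k}\le a_{n,k+1}$ for all $n,k$. The Köthe space is $K(a_{n,k})=\{x=(x_n)_{n\in\mathbb{N}}:\|x\|_k:=\sum_n|x_n|a_{n,k}<\infty\ \forall k\in\mathbb{N}\}$, a Fréchet space with the seminorms $\|\cdot\|_k$. For $\beta=(\beta_n)_{n\in\mathbb{N}}$ non-negative, increasing, with $\beta_n\to\infty$, the power series space of finite type $\Lambda_1(\beta)$ is the Köthe space with matrix $(e^{-\frac1k\beta_n})_{n,k}$. $e_n$ is the sequence with $1$ in the $n$-th place and $0$ elsewhere. A linear map $T:E\to F$ of Fréchet spaces is compact if $T(U)$ is precompact in $F$ for some neighborhood $U$ of zero in $E$. For a sequence $\theta=(\theta_0,\theta_1,\theta_2,\dots)$ (regarded as an element of a sequence space indexed by $\mathbb{N}$ by letting its $n$-th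 coordinate be $\theta_{n-1}$), the operator $\hat T_\theta$ given by the lower triangular Toeplitz matrix of $\theta$ is $\hat T_\theta e_n=\sum_{j=n}^\infty\theta_{j-n}e_j$, $\hat T_\theta x=\sum_n x_n\hat T_\theta e_n$ for $x=\sum_n x_ne_n$; it is well-defined if each $\hat T_\theta e_n$ lies in the target space and the series converges there for every $x$ in the domain. Saying that $\hat T_\theta$ is compact includes that it is well-defined. Standing assumption: $\theta_t\ne 0$ for infinitely many $t$. *)

theory Defs
  imports "HOL-Analysis.Analysis"
begin

text \<open>
  Index convention: the positive integers used as sequence indices, and as seminorm indices, are
  encoded by the type \<^typ>\<open>nat\<close> via \<open>n \<mapsto> n - 1\<close>, so every index starts at 0. In particular the
  positive integer \<open>k\<close> occurring in \<open>exp (- \<beta>\<^sub>n / k)\<close> becomes \<open>Suc k\<close>, while a scalar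
  sequence \<open>\<theta>\<close> indexed from 0 is an element of a sequence space without any shift.
\<close>

definition koethe_matrix :: "(nat \<Rightarrow> nat \<Rightarrow> real) \<Rightarrow> bool" where
  "koethe_matrix a \<longleftrightarrow>
     (\<forall>n k. 0 \<le> a n k) \<and> (\<forall>n. \<exists>k. 0 < a n k) \<and> (\<forall>n k. a n k \<le> a n (Suc k))"

definition koethe_space :: "(nat \<Rightarrow> nat \<Rightarrow> real) \<Rightarrow> (nat \<Rightarrow> 'a::real_normed_field) set" where
  "koethe_space a = {x. \<forall>k. summable (\<lambda>n. norm (x n) * a n k)}"

definition koethe_seminorm ::
  "(nat \<Rightarrow> nat \<Rightarrow> real) \<Rightarrow> nat \<Rightarrow> (nat \<Rightarrow> 'a::real_normed_field) \<Rightarrow> real" where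
  "koethe_seminorm a k x = (\<Sum>n. norm (x n) * a n k)"

definition koethe_ball ::
  "(nat \<Rightarrow> nat \<Rightarrow> real) \<Rightarrow> nat \<Rightarrow> (nat \<Rightarrow> 'a::real_normed_field) \<Rightarrow> real \<Rightarrow> (nat \<Rightarrow> 'a) set" where
  "koethe_ball a k x r = {y \<in> koethe_space a. koethe_seminorm a k (\<lambda>n. y n - x n) < r}"

definition koethe_topology ::
  "(nat \<Rightarrow> nat \<Rightarrow> real) \<Rightarrow> (nat \<Rightarrow> 'a::real_normed_field) topology" where
  "koethe_topology a =
     topology_generated_by {koethe_ball a k x r |k x r. x \<in> koethe_space a \<and> 0 < r}"

lemma topspace_koethe_topology:
  "topspace (koethe_topology a :: (nat \<Rightarrow> 'a::real_normed_field) topology) = koethe_space a"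
  unfolding koethe_topology_def topology_generated_by_topspace
proof (intro equalityI subsetI)
  fix x :: "nat \<Rightarrow> 'a"
  assume x: "x \<in> koethe_space a"
  then have "x \<in> koethe_ball a 0 x 1"
    by (simp add: koethe_ball_def koethe_seminorm_def)
  moreover have "koethe_ball a 0 x 1 \<in> {koethe_ball a k x r |k x r. x \<in> koethe_space a \<and> 0 < r}"
    using x zero_less_one by blast
  ultimately show "x \<in> \<Union> {koethe_ball a k x r |k x r. x \<in> koethe_space a \<and> 0 < r}"
    by (rule UnionI[rotated])
qed (auto simp: koethe_ball_def)

definition zero_nbhd ::
  "(nat \<Rightarrow> nat \<Rightarrow> real) \<Rightarrow> (nat \<Rightarrow> 'a::real_normed_field) set \<Rightarrow> bool" where
  "zero_nbhd a U \<longleftrightarrow>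
     U \<subseteq> koethe_space a \<and> (\<exists>W. openin (koethe_topology a) W \<and> (\<lambda>_. 0) \<in> W \<and> W \<subseteq> U)"

text \<open>Precompact means totally bounded: covered by finitely many translates of each
  neighbourhood of zero.\<close>

definition precompact_in ::
  "(nat \<Rightarrow> nat \<Rightarrow> real) \<Rightarrow> (nat \<Rightarrow> 'a::real_normed_field) set \<Rightarrow> bool" where
  "precompact_in a A \<longleftrightarrow>
     A \<subseteq> koethe_space a \<and>
     (\<forall>V. zero_nbhd a V \<longrightarrow>
        (\<exists>M. finite M \<and> M \<subseteq> koethe_space a \<and> A \<subseteq> (\<Union>x\<in>M. {\<lambda>n. x n + v n |v. v \<in> V})))"

definition koethe_linear ::
  "(nat \<Rightarrow> nat \<Rightarrow> real) \<Rightarrow> (nat \<Rightarrow> nat \<Rightarrow> real) \<Rightarrow>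
     ((nat \<Rightarrow> 'a::real_normed_field) \<Rightarrow> (nat \<Rightarrow> 'a)) \<Rightarrow> bool" where
  "koethe_linear a b T \<longleftrightarrow>
     T ` koethe_space a \<subseteq> koethe_space b \<and>
     (\<forall>x\<in>koethe_space a. \<forall>y\<in>koethe_space a. T (\<lambda>n. x n + y n) = (\<lambda>j. T x j + T y j)) \<and>
     (\<forall>c. \<forall>x\<in>koethe_space a. T (\<lambda>n. c * x n) = (\<lambda>j. c * T x j))"

definition koethe_compact ::
  "(nat \<Rightarrow> nat \<Rightarrow> real) \<Rightarrow> (nat \<Rightarrow> nat \<Rightarrow> real) \<Rightarrow>
     ((nat \<Rightarrow> 'a::real_normed_field) \<Rightarrow> (nat \<Rightarrow> 'a)) \<Rightarrow> bool" where
  "koethe_compact a b T \<longleftrightarrow>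
     koethe_linear a b T \<and> (\<exists>U. zero_nbhd a U \<and> precompact_in b (T ` U))"

definition finite_type_exponents :: "(nat \<Rightarrow> real) \<Rightarrow> bool" where
  "finite_type_exponents \<beta> \<longleftrightarrow> (\<forall>n. 0 \<le> \<beta> n) \<and> mono \<beta> \<and> filterlim \<beta> at_top sequentially"

definition finite_type_matrix :: "(nat \<Rightarrow> real) \<Rightarrow> nat \<Rightarrow> nat \<Rightarrow> real" where
  "finite_type_matrix \<beta> n k = exp (- (1 / real (Suc k)) * \<beta> n)"

abbreviation power_series_space_finite ::
  "(nat \<Rightarrow> real) \<Rightarrow> (nat \<Rightarrow> 'a::real_normed_field) set" (\<open>\<Lambda>\<^sub>1\<close>) where
  "\<Lambda>\<^sub>1 \<beta> \<equiv> koethe_space (finite_type_matrix \<beta>)"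

text \<open>The image of the \<open>n\<close>-th unit vector, i.e. the \<open>n\<close>-th column of the Toeplitz matrix.\<close>

definition toeplitz_column :: "(nat \<Rightarrow> 'a::real_normed_field) \<Rightarrow> nat \<Rightarrow> nat \<Rightarrow> 'a" where
  "toeplitz_column \<theta> n = (\<lambda>j. if n \<le> j then \<theta> (j - n) else 0)"

definition toeplitz_limit ::
  "(nat \<Rightarrow> nat \<Rightarrow> real) \<Rightarrow> (nat \<Rightarrow> 'a::real_normed_field) \<Rightarrow> (nat \<Rightarrow> 'a) \<Rightarrow> (nat \<Rightarrow> 'a) \<Rightarrow> bool" where
  "toeplitz_limit b \<theta> x y \<longleftrightarrow>
     limitin (koethe_topology b) (\<lambda>N j. \<Sum>n<N. x n * toeplitz_column \<theta> n j) y sequentially"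

definition toeplitz_well_defined ::
  "(nat \<Rightarrow> nat \<Rightarrow> real) \<Rightarrow> (nat \<Rightarrow> nat \<Rightarrow> real) \<Rightarrow> (nat \<Rightarrow> 'a::real_normed_field) \<Rightarrow> bool" where
  "toeplitz_well_defined a b \<theta> \<longleftrightarrow>
     (\<forall>n. toeplitz_column \<theta> n \<in> koethe_space b) \<and>
     (\<forall>x\<in>koethe_space a. \<exists>y. toeplitz_limit b \<theta> x y)"

text \<open>For a Koethe matrix \<open>b\<close> the topology is Hausdorff, so the limit is unique; the value is
  meaningful only when the operator is well-defined.\<close>

definition toeplitz_operator ::
  "(nat \<Rightarrow> nat \<Rightarrow> real) \<Rightarrow> (nat \<Rightarrow> 'a::real_normed_field) \<Rightarrow> (nat \<Rightarrow> 'a) \<Rightarrow> (nat \<Rightarrow> 'a)" where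
  "toeplitz_operator b \<theta> x = (THE y. toeplitz_limit b \<theta> x y)"

definition toeplitz_compact ::
  "(nat \<Rightarrow> nat \<Rightarrow> real) \<Rightarrow> (nat \<Rightarrow> nat \<Rightarrow> real) \<Rightarrow> (nat \<Rightarrow> 'a::real_normed_field) \<Rightarrow> bool" where
  "toeplitz_compact a b \<theta> \<longleftrightarrow>
     toeplitz_well_defined a b \<theta> \<and> koethe_compact a b (toeplitz_operator b \<theta>)"

end

theory Submission
  imports Defs
begin

text \<open>
  Write \<open>b\<close> for the matrix of \<^term>\<open>\<Lambda>\<^sub>1 \<beta>\<close>. Both sides of the equivalence are compared with the
  statement that the columns of the Toeplitz matrix lie in \<^term>\<open>\<Lambda>\<^sub>1 \<beta>\<close> and that one seminorm
  index \<open>m\<close> controls all their seminorms: for every \<open>k\<close> there is \<open>C\<close> such that the \<open>k\<close>-th seminorm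
  of the \<open>n\<close>-th column is at most \<open>C * a n m\<close> for all \<open>n\<close>.

  A compact operator maps some ball of index \<open>m\<close> into a set on which every seminorm is bounded;
  testing with multiples of the unit vectors gives the column estimate
  (\<open>compact_imp_column_bound\<close>). The entry \<open>\<theta> s\<^sub>0\<close> stands in row \<open>n + s\<^sub>0\<close> of the \<open>n\<close>-th
  column, so the seminorm of this column dominates \<open>norm (\<theta> s\<^sub>0) * b (n + s\<^sub>0) k\<close>, and the exponential
  condition follows; also \<open>\<theta>\<close> itself is the column with index \<open>0\<close>.

  Conversely, \<open>\<beta>\<close> is increasing, hence \<open>\<beta> (n + t)\<close> is at least the mean of \<open>\<beta> t\<close> and
  \<open>\<beta> (n + s\<^sub>0)\<close> when \<open>t \<ge> s\<^sub>0\<close>, and \<open>\<theta> t\<close> vanishes when \<open>t < s\<^sub>0\<close>. In a space of finite type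
  halving the exponent only replaces one seminorm by another, so the \<open>k\<close>-th seminorm of the \<open>n\<close>-th column
  is at most a seminorm of \<open>\<theta>\<close> times \<open>b (n + s\<^sub>0) (2 * k + 1)\<close>
  (\<open>toeplitz_column_finite_type\<close>). The hypothesis
  turns this into the column estimate, which makes the operator well defined and bounded on a ball
  (\<open>toeplitz_product_bound\<close>, \<open>column_bound_imp_limit\<close>). Finally, since \<open>\<beta>\<close> tends to infinity,
  bounded subsets of \<^term>\<open>\<Lambda>\<^sub>1 \<beta>\<close> are precompact (\<open>precompact_in_of_bounded\<close>).
\<close>

section \<open>Seminorms and topology of Koethe spaces\<close>

lemma koethe_matrix_nonneg: "koethe_matrix a \<Longrightarrow> 0 \<le> a n k"
  by (simp add: koethe_matrix_def)

lemma koethe_matrix_mono: "koethe_matrix a \<Longrightarrow> k \<le> l \<Longrightarrow> a n k \<le> a n l"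
  unfolding koethe_matrix_def by (rule lift_Suc_mono_le[of "a n"]) auto

lemma koethe_space_summable: "x \<in> koethe_space a \<Longrightarrow> summable (\<lambda>n. norm (x n) * a n k)"
  by (simp add: koethe_space_def)

lemma koethe_space_zero [simp]: "(\<lambda>_. 0) \<in> koethe_space a"
  by (simp add: koethe_space_def)

lemma koethe_space_finite_support:
  assumes "\<And>n. n \<ge> N \<Longrightarrow> x n = 0"
  shows "x \<in> koethe_space a"
  unfolding koethe_space_def
  by (intro CollectI allI summable_finite[of "{..<N}"]) (simp_all add: assms)

lemma koethe_space_dominated:
  assumes "koethe_matrix a" "y \<in> koethe_space a" "\<And>n. norm (x n) \<le> norm (y n)"
  shows "x \<in> koethe_space a"
proof -
  have "summable (\<lambda>n. norm (x n) * a n k)" for k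
    by (rule summable_comparison_test'[OF koethe_space_summable[OF assms(2), of k]])
      (simp add: assms koethe_matrix_nonneg mult_right_mono)
  then show ?thesis
    by (simp add: koethe_space_def)
qed

lemma koethe_space_add:
  assumes a: "koethe_matrix a" and "x \<in> koethe_space a" "y \<in> koethe_space a"
  shows "(\<lambda>n. x n + y n) \<in> koethe_space a"
    and "koethe_seminorm a k (\<lambda>n. x n + y n) \<le> koethe_seminorm a k x + koethe_seminorm a k y"
proof -
  have le: "norm (x n + y n) * a n k \<le> norm (x n) * a n k + norm (y n) * a n k" for n k
    using mult_right_mono[OF norm_triangle_ineq koethe_matrix_nonneg[OF a], of "x n" "y n" n k]
    by (simp add: distrib_right)
  have sm: "summable (\<lambda>n. norm (x n) * a n k + norm (y n) * a n k)" for k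
    by (intro summable_add koethe_space_summable assms)
  have s: "summable (\<lambda>n. norm (x n + y n) * a n k)" for k
    by (rule summable_comparison_test'[OF sm[of k]])
      (use le in \<open>simp add: koethe_matrix_nonneg[OF a]\<close>)
  then show "(\<lambda>n. x n + y n) \<in> koethe_space a"
    by (simp add: koethe_space_def)
  have "koethe_seminorm a k (\<lambda>n. x n + y n)
      \<le> (\<Sum>n. norm (x n) * a n k + norm (y n) * a n k)"
    unfolding koethe_seminorm_def by (intro suminf_le le s sm)
  also have "\<dots> = koethe_seminorm a k x + koethe_seminorm a k y"
    unfolding koethe_seminorm_def by (intro suminf_add[symmetric] koethe_space_summable assms)
  finally show "koethe_seminorm a k (\<lambda>n. x n + y n)
      \<le> koethe_seminorm a k x + koethe_seminorm a k y" .
qed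

lemma koethe_space_scale:
  assumes "x \<in> koethe_space a"
  shows "(\<lambda>n. c * x n) \<in> koethe_space a"
    and "koethe_seminorm a k (\<lambda>n. c * x n) = norm c * koethe_seminorm a k x"
  using koethe_space_summable[OF assms]
  by (auto simp: koethe_space_def koethe_seminorm_def norm_mult mult.assoc
      intro: summable_mult suminf_mult)

lemma koethe_space_diff:
  assumes "koethe_matrix a" "x \<in> koethe_space a" "y \<in> koethe_space a"
  shows "(\<lambda>n. x n - y n) \<in> koethe_space a"
  using koethe_space_add(1)[OF assms(1,2) koethe_space_scale(1)[OF assms(3), of "-1"]] by simp

lemma koethe_seminorm_nonneg:
  "koethe_matrix a \<Longrightarrow> x \<in> koethe_space a \<Longrightarrow> 0 \<le> koethe_seminorm a k x"
  unfolding koethe_seminorm_def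
  by (intro suminf_nonneg koethe_space_summable) (auto simp: koethe_matrix_nonneg)

lemma koethe_seminorm_zero [simp]: "koethe_seminorm a k (\<lambda>_. 0) = 0"
  by (simp add: koethe_seminorm_def)

lemma koethe_seminorm_mono:
  assumes "koethe_matrix a" "x \<in> koethe_space a" "k \<le> l"
  shows "koethe_seminorm a k x \<le> koethe_seminorm a l x"
  unfolding koethe_seminorm_def
  by (intro suminf_le koethe_space_summable assms mult_left_mono koethe_matrix_mono norm_ge_zero)

lemma koethe_coordinate_le:
  assumes "koethe_matrix a" "x \<in> koethe_space a"
  shows "norm (x n) * a n k \<le> koethe_seminorm a k x"
  unfolding koethe_seminorm_def
  using sum_le_suminf[OF koethe_space_summable[OF assms(2)], of "{n}" k]
  by (simp add: koethe_matrix_nonneg assms(1))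

lemma koethe_seminorm_unit_vector:
  "koethe_seminorm a k (\<lambda>i. if i = n then c else 0) = norm c * a n k"
  unfolding koethe_seminorm_def
  by (subst suminf_finite[of "{n}"]) auto

text \<open>The balls around a point with all indices and radii already form a neighbourhood base there,
  because the seminorms increase with the index, so that an intersection of two balls contains
  a single one.\<close>

lemma openin_koethe_topology_contains_ball:
  fixes x :: "nat \<Rightarrow> 'a::real_normed_field"
  assumes a: "koethe_matrix a" and "openin (koethe_topology a) W" "x \<in> W"
  shows "\<exists>k r. 0 < r \<and> koethe_ball a k x r \<subseteq> W"
proof -
  have "generate_topology_on {koethe_ball a k x r |k x r. x \<in> koethe_space a \<and> 0 < r} W"
    using assms(2) by (simp add: koethe_topology_def openin_topology_generated_by_iff)
  then show ?thesis
    using \<open>x \<in> W\<close>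
  proof induction
    case Empty
    then show ?case by simp
  next
    case (Int U V)
    then obtain k r l s where
      "0 < r" "koethe_ball a k x r \<subseteq> U" "0 < s" "koethe_ball a l x s \<subseteq> V"
      by blast
    moreover have xs: "x \<in> koethe_space a"
      using Int.hyps Int.prems topspace_koethe_topology[of a, where 'a='a]
        openin_subset[of "koethe_topology a" U]
      by (auto simp: koethe_topology_def openin_topology_generated_by_iff)
    moreover have "koethe_ball a (max k l) x (min r s) \<subseteq> koethe_ball a k x r \<inter> koethe_ball a l x s"
    proof
      fix y assume "y \<in> koethe_ball a (max k l) x (min r s)"
      then have y: "y \<in> koethe_space a"
        and lt: "koethe_seminorm a (max k l) (\<lambda>n. y n - x n) < min r s"
        by (auto simp: koethe_ball_def)
      have "koethe_seminorm a k (\<lambda>n. y n - x n) \<le> koethe_seminorm a (max k l) (\<lambda>n. y n - x n)"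
        "koethe_seminorm a l (\<lambda>n. y n - x n) \<le> koethe_seminorm a (max k l) (\<lambda>n. y n - x n)"
        by (intro koethe_seminorm_mono koethe_space_diff a y xs; simp)+
      with lt y show "y \<in> koethe_ball a k x r \<inter> koethe_ball a l x s"
        by (simp add: koethe_ball_def)
    qed
    ultimately show ?case
      by (intro exI[of _ "max k l"] exI[of _ "min r s"]) auto
  next
    case (UN K)
    then show ?case by blast
  next
    case (Basis B)
    then obtain k z r where B: "B = koethe_ball a k z r" and z: "z \<in> koethe_space a"
      by blast
    define d where "d = koethe_seminorm a k (\<lambda>n. x n - z n)"
    have x: "x \<in> koethe_space a" and d: "d < r"
      using Basis.prems by (auto simp: B d_def koethe_ball_def)
    have "koethe_ball a k x (r - d) \<subseteq> B"
    proof
      fix y assume "y \<in> koethe_ball a k x (r - d)"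
      then have y: "y \<in> koethe_space a" and lt: "koethe_seminorm a k (\<lambda>n. y n - x n) < r - d"
        by (auto simp: koethe_ball_def)
      have "koethe_seminorm a k (\<lambda>n. (y n - x n) + (x n - z n))
          \<le> koethe_seminorm a k (\<lambda>n. y n - x n) + d"
        unfolding d_def by (intro koethe_space_add koethe_space_diff a x y z)
      with lt y show "y \<in> B"
        by (simp add: B koethe_ball_def)
    qed
    with d show ?case
      by (intro exI[of _ k] exI[of _ "r - d"]) auto
  qed
qed

lemma openin_koethe_ball:
  "x \<in> koethe_space a \<Longrightarrow> 0 < r \<Longrightarrow> openin (koethe_topology a) (koethe_ball a k x r)"
  unfolding koethe_topology_def by (rule topology_generated_by_Basis) blast

lemma koethe_ball_centre: "x \<in> koethe_space a \<Longrightarrow> 0 < r \<Longrightarrow> x \<in> koethe_ball a k x r"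
  by (simp add: koethe_ball_def)

lemma zero_nbhd_koethe_ball: "0 < r \<Longrightarrow> zero_nbhd a (koethe_ball a k (\<lambda>_. 0) r)"
  unfolding zero_nbhd_def
  by (intro conjI exI[of _ "koethe_ball a k (\<lambda>_. 0) r"] openin_koethe_ball koethe_ball_centre)
    (auto simp: koethe_ball_def)

lemma zero_nbhd_contains_ball:
  assumes "koethe_matrix a" "zero_nbhd a U"
  obtains k r where "0 < r" "koethe_ball a k (\<lambda>_. 0) r \<subseteq> U"
proof -
  obtain W where "openin (koethe_topology a) W" "(\<lambda>_. 0) \<in> W" "W \<subseteq> U"
    using assms(2) by (auto simp: zero_nbhd_def)
  with openin_koethe_topology_contains_ball[OF assms(1)] that show thesis
    by (meson order_trans)
qed

lemma limitin_koethe_topologyI: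
  assumes a: "koethe_matrix a" and y: "y \<in> koethe_space a" and f: "\<And>i. f i \<in> koethe_space a"
    and lim: "\<And>k. ((\<lambda>i. koethe_seminorm a k (\<lambda>n. f i n - y n)) \<longlongrightarrow> 0) F"
  shows "limitin (koethe_topology a) f y F"
  unfolding limitin_def topspace_koethe_topology
proof (intro conjI y allI impI)
  fix W assume "openin (koethe_topology a) W \<and> y \<in> W"
  then obtain k r where r: "0 < r" "koethe_ball a k y r \<subseteq> W"
    using openin_koethe_topology_contains_ball[OF a] by meson
  have "\<forall>\<^sub>F i in F. koethe_seminorm a k (\<lambda>n. f i n - y n) < r"
    using order_tendstoD(2)[OF lim r(1)] .
  then show "\<forall>\<^sub>F i in F. f i \<in> W"
    by eventually_elim (use f r in \<open>auto simp: koethe_ball_def\<close>)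
qed

text \<open>Every index carries a positive weight for some seminorm, so convergence in a Koethe space
  forces convergence of each coordinate. This is what makes the limits unique.\<close>

lemma limitin_koethe_topology_coordinate:
  assumes a: "koethe_matrix a" and lim: "limitin (koethe_topology a) f y F"
  shows "((\<lambda>i. f i n) \<longlongrightarrow> y n) F"
proof (rule tendstoI)
  fix e :: real assume "0 < e"
  have y: "y \<in> koethe_space a"
    using lim by (simp add: limitin_def topspace_koethe_topology)
  obtain k where k: "0 < a n k"
    using a unfolding koethe_matrix_def by blast
  then have "0 < e * a n k"
    using \<open>0 < e\<close> by simp
  then have "\<forall>\<^sub>F i in F. f i \<in> koethe_ball a k y (e * a n k)"
    using lim openin_koethe_ball[OF y] koethe_ball_centre[OF y] by (auto simp: limitin_def)
  then show "\<forall>\<^sub>F i in F. dist (f i n) (y n) < e"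
  proof eventually_elim
    case (elim i)
    then have "koethe_seminorm a k (\<lambda>n. f i n - y n) < e * a n k"
      and "(\<lambda>n. f i n - y n) \<in> koethe_space a"
      by (auto simp: koethe_ball_def intro!: koethe_space_diff a y)
    with koethe_coordinate_le[OF a this(2), of n k] have "norm (f i n - y n) * a n k < e * a n k"
      by linarith
    with k show ?case
      by (simp add: dist_norm)
  qed
qed

section \<open>Bounded and precompact sets\<close>

lemma precompact_in_imp_bounded:
  assumes b: "koethe_matrix b" and A: "precompact_in b A"
  shows "\<exists>R. \<forall>y\<in>A. koethe_seminorm b k y \<le> R"
proof -
  obtain M where M: "finite M" "M \<subseteq> koethe_space b"
    "A \<subseteq> (\<Union>x\<in>M. {\<lambda>n. x n + v n |v. v \<in> koethe_ball b k (\<lambda>_. 0) 1})"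
    using A[unfolded precompact_in_def, THEN conjunct2, rule_format,
        OF zero_nbhd_koethe_ball[OF zero_less_one, of b k]]
    by (elim exE conjE)
  define R where "R = (\<Sum>x\<in>M. koethe_seminorm b k x) + 1"
  have "koethe_seminorm b k y \<le> R" if y: "y \<in> A" for y
  proof -
    obtain x v where x: "x \<in> M" and v: "v \<in> koethe_ball b k (\<lambda>_. 0) 1" "y = (\<lambda>n. x n + v n)"
      using subsetD[OF M(3) y] by (elim UN_E CollectE exE conjE) (rule that)
    have "koethe_seminorm b k y \<le> koethe_seminorm b k x + koethe_seminorm b k v"
      unfolding v(2) using x M(2) v(1)
      by (intro koethe_space_add b) (auto simp: koethe_ball_def)
    moreover have "koethe_seminorm b k v < 1"
      using v(1) by (simp add: koethe_ball_def)
    moreover have "koethe_seminorm b k x \<le> (\<Sum>x\<in>M. koethe_seminorm b k x)"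
      using M(1,2) x by (intro member_le_sum koethe_seminorm_nonneg b) auto
    ultimately show ?thesis
      by (simp add: R_def)
  qed
  then show ?thesis by blast
qed

text \<open>If each column of \<open>b\<close> is negligible against a later one, then on a bounded set the tails of the
  \<open>k\<close>-th seminorm are uniformly small, being dominated by a small multiple of the \<open>l\<close>-th seminorm.
  What remains is finitely many bounded coordinates, for which bounded closed sets of scalars
  being compact provides finite nets.\<close>

lemma precompact_in_of_bounded:
  fixes A :: "(nat \<Rightarrow> 'a::{real_normed_field, heine_borel}) set"
  assumes b: "koethe_matrix b"
    and schwartz: "\<And>k. \<exists>l. \<forall>e>0. \<forall>\<^sub>F n in sequentially. b n k \<le> e * b n l"
    and A: "A \<subseteq> koethe_space b"
    and bounded: "\<And>k. \<exists>R. \<forall>y\<in>A. koethe_seminorm b k y \<le> R"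
  shows "precompact_in b A"
  unfolding precompact_in_def
proof (intro conjI A allI impI)
  fix V :: "(nat \<Rightarrow> 'a) set" assume "zero_nbhd b V"
  then obtain k r where r: "0 < r" "koethe_ball b k (\<lambda>_. 0) r \<subseteq> V"
    by (rule zero_nbhd_contains_ball[OF b])
  obtain l where l: "\<And>e. e > 0 \<Longrightarrow> \<forall>\<^sub>F n in sequentially. b n k \<le> e * b n l"
    using schwartz by blast
  obtain R where R: "\<And>y. y \<in> A \<Longrightarrow> koethe_seminorm b l y \<le> R"
    using bounded by blast
  \<comment> \<open>The tails from \<open>J\<close> on contribute at most \<open>r / 2\<close>; the absolute value covers a negative
    bound \<open>R\<close> of an empty set.\<close>
  define e where "e = r / (2 * (\<bar>R\<bar> + 1))"
  have e: "0 < e" "e * (\<bar>R\<bar> + 1) = r / 2"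
    using r(1) by (auto simp: e_def field_simps)
  have "e * R < e * (\<bar>R\<bar> + 1)"
    using e(1) by (intro mult_strict_left_mono) auto
  with e(2) have eR: "e * R < r / 2"
    by simp
  obtain J where J: "\<And>n. n \<ge> J \<Longrightarrow> b n k \<le> e * b n l"
    using l[OF e(1)] by (auto simp: eventually_sequentially)
  \<comment> \<open>A net of mesh \<open>d\<close> in each of the first \<open>J\<close> coordinates costs at most another \<open>r / 2\<close>.\<close>
  define d where "d = r / (2 * ((\<Sum>j<J. b j k) + 1))"
  have B: "0 \<le> (\<Sum>j<J. b j k)"
    by (intro sum_nonneg koethe_matrix_nonneg b)
  have d: "0 < d" "d * ((\<Sum>j<J. b j k) + 1) = r / 2"
    using r(1) B by (auto simp: d_def field_simps)
  have dB: "(\<Sum>j<J. d * b j k) \<le> r / 2"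
    using d by (simp add: distrib_left sum_distrib_left)
  have "\<exists>N. finite N \<and> (\<forall>y\<in>A. \<exists>c\<in>N. norm (y j - c) < d)" for j
  proof -
    obtain i where i: "0 < b j i"
      using b unfolding koethe_matrix_def by blast
    obtain S where S: "\<And>y. y \<in> A \<Longrightarrow> koethe_seminorm b i y \<le> S"
      using bounded by blast
    have "compact (cball (0::'a) (S / b j i))"
      by (rule compact_cball)
    then obtain N where N: "finite N" "cball (0::'a) (S / b j i) \<subseteq> (\<Union>c\<in>N. ball c d)"
      using d(1) unfolding compact_eq_totally_bounded by blast
    have "\<exists>c\<in>N. norm (y j - c) < d" if y: "y \<in> A" for y
    proof -
      have "norm (y j) * b j i \<le> S"
        using koethe_coordinate_le[OF b, of y j i] S[OF y] A y by auto
      then have "y j \<in> cball 0 (S / b j i)"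
        using i by (simp add: field_simps)
      with N(2) obtain c where "c \<in> N" "y j \<in> ball c d"
        by blast
      then show ?thesis
        by (auto simp: dist_norm norm_minus_commute)
    qed
    with N(1) show ?thesis by blast
  qed
  then obtain N where N: "\<And>j. finite (N j)" "\<And>j y. y \<in> A \<Longrightarrow> \<exists>c\<in>N j. norm (y j - c) < d"
    by metis
  define M where "M = (\<lambda>z j. if j < J then z j else 0) ` PiE {..<J} N"
  show "\<exists>M. finite M \<and> M \<subseteq> koethe_space b \<and> A \<subseteq> (\<Union>x\<in>M. {\<lambda>n. x n + v n |v. v \<in> V})"
  proof (intro exI[of _ M] conjI subsetI)
    show "finite M"
      unfolding M_def by (rule finite_imageI, rule finite_PiE) (simp_all add: N(1))
    show M: "x \<in> koethe_space b" if x: "x \<in> M" for x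
    proof -
      obtain z where "x = (\<lambda>j. if j < J then z j else 0)"
        using x unfolding M_def by (elim imageE)
      then show ?thesis
        by (intro koethe_space_finite_support[of J]) simp
    qed
    fix y assume y: "y \<in> A"
    then obtain z where z: "\<And>j. z j \<in> N j" "\<And>j. norm (y j - z j) < d"
      using N(2) by metis
    define x where "x = (\<lambda>j. if j < J then z j else 0)"
    have "x = (\<lambda>j. if j < J then restrict z {..<J} j else 0)"
      by (auto simp: x_def)
    then have x: "x \<in> M"
      unfolding M_def using z(1) by (intro image_eqI[of _ _ "restrict z {..<J}"]) auto
    have ys: "y \<in> koethe_space b"
      using A y by auto
    have v: "(\<lambda>n. y n - x n) \<in> koethe_space b"
      by (intro koethe_space_diff b ys M x)
    have le: "norm (y n - x n) * b n k
        \<le> (if n \<in> {..<J} then d * b n k else 0) + e * (norm (y n) * b n l)" for n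
    proof (cases "n < J")
      case True
      then have "norm (y n - x n) * b n k \<le> d * b n k"
        using z(2)[of n] by (intro mult_right_mono koethe_matrix_nonneg b) (simp add: x_def)
      moreover have "0 \<le> e * (norm (y n) * b n l)"
        using e(1) koethe_matrix_nonneg[OF b] by simp
      ultimately show ?thesis
        using True by simp
    next
      case False
      then have "norm (y n) * b n k \<le> norm (y n) * (e * b n l)"
        by (intro mult_left_mono J) auto
      with False show ?thesis
        by (simp add: x_def ac_simps)
    qed
    have sums: "(\<lambda>n. (if n \<in> {..<J} then d * b n k else 0) + e * (norm (y n) * b n l))
        sums ((\<Sum>j<J. d * b j k) + e * koethe_seminorm b l y)"
      unfolding koethe_seminorm_def
      by (intro sums_add sums_mult sums_If_finite_set summable_sums koethe_space_summable ys) simp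
    have "koethe_seminorm b k (\<lambda>n. y n - x n) \<le> (\<Sum>j<J. d * b j k) + e * koethe_seminorm b l y"
      using sums_le[OF le summable_sums[OF koethe_space_summable[OF v]] sums]
      by (simp add: koethe_seminorm_def)
    also have "\<dots> \<le> r / 2 + e * R"
      using dB e(1) R[OF y] by (intro add_mono mult_left_mono) auto
    also have "\<dots> < r"
      using eR by simp
    finally have "(\<lambda>n. y n - x n) \<in> V"
      using v r(2) by (auto simp: koethe_ball_def)
    moreover have "y = (\<lambda>n. x n + (y n - x n))"
      by simp
    ultimately show "y \<in> (\<Union>x\<in>M. {\<lambda>n. x n + v n |v. v \<in> V})"
      using x by (intro UN_I[of x] CollectI exI[of _ "\<lambda>n. y n - x n"] conjI)
  qed
qed

section \<open>Toeplitz operators between Koethe spaces\<close>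

text \<open>By triangularity the sum over all columns is finite in each row.\<close>

definition toeplitz_product :: "(nat \<Rightarrow> 'a::real_normed_field) \<Rightarrow> (nat \<Rightarrow> 'a) \<Rightarrow> nat \<Rightarrow> 'a" where
  "toeplitz_product \<theta> x j = (\<Sum>n\<le>j. x n * toeplitz_column \<theta> n j)"

lemma toeplitz_partial_sum:
  "(\<Sum>n<N. x n * toeplitz_column \<theta> n j)
    = toeplitz_product \<theta> x j - toeplitz_product \<theta> (\<lambda>n. if n < N then 0 else x n) j"
proof -
  have "(\<Sum>n<N. x n * toeplitz_column \<theta> n j) = (\<Sum>n\<in>{..<N}\<inter>{..j}. x n * toeplitz_column \<theta> n j)"
    by (rule sum.mono_neutral_right) (auto simp: toeplitz_column_def)
  also have "\<dots> = (\<Sum>n\<le>j. if n < N then x n * toeplitz_column \<theta> n j else 0)"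
    by (subst sum.inter_filter[symmetric]) (auto intro!: sum.cong)
  also have "\<dots> = toeplitz_product \<theta> x j - toeplitz_product \<theta> (\<lambda>n. if n < N then 0 else x n) j"
    unfolding toeplitz_product_def sum_subtractf[symmetric] by (rule sum.cong) auto
  finally show ?thesis .
qed

lemma toeplitz_limit_eq_product:
  assumes b: "koethe_matrix b" and lim: "toeplitz_limit b \<theta> x y"
  shows "y = toeplitz_product \<theta> x"
proof
  fix j
  have "(\<lambda>N. \<Sum>n<N. x n * toeplitz_column \<theta> n j) \<longlonglongrightarrow> y j"
    using limitin_koethe_topology_coordinate[OF b lim[unfolded toeplitz_limit_def]] .
  moreover have "\<forall>\<^sub>F N in sequentially. (\<Sum>n<N. x n * toeplitz_column \<theta> n j) = toeplitz_product \<theta> x j"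
    using eventually_gt_at_top[of j]
    by eventually_elim (simp add: toeplitz_partial_sum, simp add: toeplitz_product_def)
  then have "(\<lambda>N. \<Sum>n<N. x n * toeplitz_column \<theta> n j) \<longlonglongrightarrow> toeplitz_product \<theta> x j"
    by (rule tendsto_eventually)
  ultimately show "y j = toeplitz_product \<theta> x j"
    by (rule LIMSEQ_unique)
qed

lemma toeplitz_operator_eq_product:
  assumes "koethe_matrix b" "toeplitz_limit b \<theta> x y"
  shows "toeplitz_operator b \<theta> x = toeplitz_product \<theta> x"
  unfolding toeplitz_operator_def
proof (rule the_equality)
  show "toeplitz_limit b \<theta> x (toeplitz_product \<theta> x)"
    using assms(2) toeplitz_limit_eq_product[OF assms] by simp
qed (rule toeplitz_limit_eq_product[OF assms(1)])

lemma toeplitz_product_unit_vector: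
  "toeplitz_product \<theta> (\<lambda>i. if i = n then c else 0) = (\<lambda>j. c * toeplitz_column \<theta> n j)"
  by (auto simp: toeplitz_product_def toeplitz_column_def if_distrib[of "\<lambda>u. u * _"] fun_eq_iff
      cong: if_cong)

lemma toeplitz_product_add:
  "toeplitz_product \<theta> (\<lambda>n. x n + y n) = (\<lambda>j. toeplitz_product \<theta> x j + toeplitz_product \<theta> y j)"
  by (simp add: toeplitz_product_def distrib_right sum.distrib fun_eq_iff)

lemma toeplitz_product_scale:
  "toeplitz_product \<theta> (\<lambda>n. c * x n) = (\<lambda>j. c * toeplitz_product \<theta> x j)"
  by (simp add: toeplitz_product_def sum_distrib_left mult.assoc fun_eq_iff)

text \<open>The images of the unit vectors determine continuity because the domain carries weighted
  \<open>\<ell>\<^sup>1\<close> seminorms: interchange the two summations, done here for finite sections of the matrix,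
  which exhaust the nonnegative double series.\<close>

lemma toeplitz_product_bound:
  assumes a: "koethe_matrix a" and b: "koethe_matrix b" and x: "x \<in> koethe_space a"
    and col: "\<And>n. toeplitz_column \<theta> n \<in> koethe_space b"
    and C: "0 \<le> C" "\<And>n. koethe_seminorm b k (toeplitz_column \<theta> n) \<le> C * a n m"
  shows "summable (\<lambda>j. norm (toeplitz_product \<theta> x j) * b j k)"
    and "koethe_seminorm b k (toeplitz_product \<theta> x) \<le> C * koethe_seminorm a m x"
proof -
  have bound: "(\<Sum>j<J. norm (toeplitz_product \<theta> x j) * b j k) \<le> C * koethe_seminorm a m x" for J
  proof -
    have "norm (toeplitz_product \<theta> x j) * b j k
        \<le> (\<Sum>n<J. norm (x n) * (norm (toeplitz_column \<theta> n j) * b j k))" if "j < J" for j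
    proof -
      have "norm (toeplitz_product \<theta> x j) \<le> (\<Sum>n\<le>j. norm (x n * toeplitz_column \<theta> n j))"
        unfolding toeplitz_product_def by (rule norm_sum)
      also have "\<dots> \<le> (\<Sum>n<J. norm (x n * toeplitz_column \<theta> n j))"
        using that by (intro sum_mono2) auto
      finally have "norm (toeplitz_product \<theta> x j) * b j k
          \<le> (\<Sum>n<J. norm (x n * toeplitz_column \<theta> n j)) * b j k"
        by (intro mult_right_mono koethe_matrix_nonneg b)
      then show ?thesis
        by (simp add: sum_distrib_right norm_mult mult.assoc)
    qed
    then have "(\<Sum>j<J. norm (toeplitz_product \<theta> x j) * b j k)
        \<le> (\<Sum>j<J. \<Sum>n<J. norm (x n) * (norm (toeplitz_column \<theta> n j) * b j k))"
      by (intro sum_mono) auto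
    also have "\<dots> = (\<Sum>n<J. norm (x n) * (\<Sum>j<J. norm (toeplitz_column \<theta> n j) * b j k))"
      by (subst sum.swap) (simp add: sum_distrib_left)
    also have "\<dots> \<le> (\<Sum>n<J. norm (x n) * (C * a n m))"
    proof (intro sum_mono mult_left_mono norm_ge_zero)
      fix n
      have "(\<Sum>j<J. norm (toeplitz_column \<theta> n j) * b j k)
          \<le> koethe_seminorm b k (toeplitz_column \<theta> n)"
        unfolding koethe_seminorm_def
        by (intro sum_le_suminf koethe_space_summable col) (auto simp: koethe_matrix_nonneg[OF b])
      then show "(\<Sum>j<J. norm (toeplitz_column \<theta> n j) * b j k) \<le> C * a n m"
        using C(2)[of n] by linarith
    qed
    also have "\<dots> = C * (\<Sum>n<J. norm (x n) * a n m)"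
      by (simp add: sum_distrib_left ac_simps)
    also have "\<dots> \<le> C * koethe_seminorm a m x"
      unfolding koethe_seminorm_def
      by (intro mult_left_mono sum_le_suminf koethe_space_summable x C)
        (auto simp: koethe_matrix_nonneg[OF a])
    finally show ?thesis .
  qed
  show "summable (\<lambda>j. norm (toeplitz_product \<theta> x j) * b j k)"
    by (rule summableI_nonneg_bounded[OF _ bound]) (simp add: koethe_matrix_nonneg[OF b])
  then show "koethe_seminorm b k (toeplitz_product \<theta> x) \<le> C * koethe_seminorm a m x"
    unfolding koethe_seminorm_def[of b] by (rule suminf_le_const[OF _ bound])
qed

text \<open>The error of a partial sum of the columns is the image of a truncation of \<open>x\<close>, whose
  \<open>m\<close>-th seminorm is the tail of a convergent series.\<close>

lemma column_bound_imp_limit: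
  assumes a: "koethe_matrix a" and b: "koethe_matrix b" and x: "x \<in> koethe_space a"
    and col: "\<And>n. toeplitz_column \<theta> n \<in> koethe_space b"
    and C: "\<And>k. 0 \<le> C k" "\<And>n k. koethe_seminorm b k (toeplitz_column \<theta> n) \<le> C k * a n m"
  shows "toeplitz_product \<theta> x \<in> koethe_space b"
    and "toeplitz_limit b \<theta> x (toeplitz_product \<theta> x)"
proof -
  have sp: "toeplitz_product \<theta> z \<in> koethe_space b" if "z \<in> koethe_space a" for z
    unfolding koethe_space_def
    using toeplitz_product_bound(1)[OF a b that col C] by blast
  then show y: "toeplitz_product \<theta> x \<in> koethe_space b"
    using x .
  define z where "z N n = (if n < N then 0 else x n)" for N n
  have z: "z N \<in> koethe_space a" for N
    by (rule koethe_space_dominated[OF a x]) (simp add: z_def)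
  have partial: "(\<Sum>n<N. x n * toeplitz_column \<theta> n j)
      = toeplitz_product \<theta> x j - toeplitz_product \<theta> (z N) j" for N j
    by (simp add: toeplitz_partial_sum z_def[abs_def])
  have z_lim: "(\<lambda>N. koethe_seminorm a m (z N)) \<longlonglongrightarrow> 0"
  proof -
    have "koethe_seminorm a m (z N) = koethe_seminorm a m x - (\<Sum>n<N. norm (x n) * a n m)" for N
    proof -
      have eq: "norm (z N n) * a n m
          = norm (x n) * a n m - (if n \<in> {..<N} then norm (x n) * a n m else 0)" for n
        by (simp add: z_def)
      have "(\<lambda>n. norm (z N n) * a n m) sums (koethe_seminorm a m x - (\<Sum>n<N. norm (x n) * a n m))"
        unfolding eq koethe_seminorm_def
        by (intro sums_diff sums_If_finite_set summable_sums koethe_space_summable x) simp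
      then show ?thesis
        by (simp add: koethe_seminorm_def sums_iff)
    qed
    moreover have "(\<lambda>N. koethe_seminorm a m x - (\<Sum>n<N. norm (x n) * a n m))
        \<longlonglongrightarrow> koethe_seminorm a m x - koethe_seminorm a m x"
      unfolding koethe_seminorm_def
      by (intro tendsto_diff tendsto_const summable_LIMSEQ koethe_space_summable x)
    ultimately show ?thesis
      by simp
  qed
  show "toeplitz_limit b \<theta> x (toeplitz_product \<theta> x)"
    unfolding toeplitz_limit_def partial
  proof (rule limitin_koethe_topologyI[OF b y])
    show "(\<lambda>j. toeplitz_product \<theta> x j - toeplitz_product \<theta> (z N) j) \<in> koethe_space b" for N
      by (intro koethe_space_diff b sp x z)
    fix k
    have err: "koethe_seminorm b k (\<lambda>n. (toeplitz_product \<theta> x n - toeplitz_product \<theta> (z N) n)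
        - toeplitz_product \<theta> x n) = koethe_seminorm b k (toeplitz_product \<theta> (z N))" for N
      by (simp add: koethe_seminorm_def)
    have bound_lim: "(\<lambda>N. C k * koethe_seminorm a m (z N)) \<longlonglongrightarrow> 0"
      using tendsto_mult_right_zero[OF z_lim] .
    show "(\<lambda>N. koethe_seminorm b k (\<lambda>n. (toeplitz_product \<theta> x n - toeplitz_product \<theta> (z N) n)
        - toeplitz_product \<theta> x n)) \<longlonglongrightarrow> 0"
      unfolding err
      by (rule tendsto_sandwich[OF _ _ tendsto_const bound_lim])
        (auto intro!: always_eventually koethe_seminorm_nonneg[OF b] sp z
          toeplitz_product_bound(2)[OF a b z col C])
  qed
qed

lemma column_bound_imp_compact:
  fixes \<theta> :: "nat \<Rightarrow> 'a::{real_normed_field, heine_borel}"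
  assumes a: "koethe_matrix a" and b: "koethe_matrix b"
    and schwartz: "\<And>k. \<exists>l. \<forall>e>0. \<forall>\<^sub>F n in sequentially. b n k \<le> e * b n l"
    and col: "\<And>n. toeplitz_column \<theta> n \<in> koethe_space b"
    and C: "\<And>k. 0 \<le> C k" "\<And>n k. koethe_seminorm b k (toeplitz_column \<theta> n) \<le> C k * a n m"
  shows "toeplitz_compact a b \<theta>"
proof -
  note lim = column_bound_imp_limit[OF a b _ col C]
  have T: "toeplitz_operator b \<theta> x = toeplitz_product \<theta> x" if "x \<in> koethe_space a" for x
    using toeplitz_operator_eq_product[OF b lim(2)[OF that]] .
  define U :: "(nat \<Rightarrow> 'a) set" where "U = koethe_ball a m (\<lambda>_. 0) 1"
  have U: "x \<in> koethe_space a" "koethe_seminorm a m x < 1" if "x \<in> U" for x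
    using that by (auto simp: U_def koethe_ball_def)
  have "precompact_in b (toeplitz_operator b \<theta> ` U)"
  proof (rule precompact_in_of_bounded[OF b schwartz])
    show "toeplitz_operator b \<theta> ` U \<subseteq> koethe_space b"
      using U(1) T lim(1) by auto
    fix k
    have "koethe_seminorm b k (toeplitz_operator b \<theta> x) \<le> C k" if x: "x \<in> U" for x
    proof -
      have "koethe_seminorm b k (toeplitz_operator b \<theta> x) \<le> C k * koethe_seminorm a m x"
        unfolding T[OF U(1)[OF x]] by (rule toeplitz_product_bound(2)[OF a b U(1)[OF x] col C])
      also have "\<dots> \<le> C k"
        using U(2)[OF x] C(1)[of k] by (simp add: mult_left_le)
      finally show ?thesis .
    qed
    then show "\<exists>R. \<forall>y\<in>toeplitz_operator b \<theta> ` U. koethe_seminorm b k y \<le> R"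
      by blast
  qed
  moreover have "zero_nbhd a U"
    unfolding U_def by (rule zero_nbhd_koethe_ball) simp
  moreover have "koethe_linear a b (toeplitz_operator b \<theta>)"
    unfolding koethe_linear_def
    using lim(1) by (auto simp: T koethe_space_add(1)[OF a] koethe_space_scale(1)
        toeplitz_product_add toeplitz_product_scale)
  moreover have "toeplitz_well_defined a b \<theta>"
    unfolding toeplitz_well_defined_def using col lim(2) by blast
  ultimately show ?thesis
    unfolding toeplitz_compact_def koethe_compact_def by blast
qed

text \<open>A bound on the image of a ball is tested on multiples of the \<open>n\<close>-th unit vector. If
  \<open>a n m = 0\<close>, arbitrarily large multiples lie in the ball, so that the column must have
  \<open>k\<close>-th seminorm zero; otherwise a multiple of size comparable to \<open>1 / a n m\<close> is available.\<close>

lemma compact_imp_column_bound: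
  fixes \<theta> :: "nat \<Rightarrow> 'a::real_normed_field"
  assumes a: "koethe_matrix a" and b: "koethe_matrix b" and comp: "toeplitz_compact a b \<theta>"
  shows "\<exists>m. \<forall>k. \<exists>C>0. \<forall>n. koethe_seminorm b k (toeplitz_column \<theta> n) \<le> C * a n m"
proof -
  have wd: "toeplitz_well_defined a b \<theta>"
    using comp by (simp add: toeplitz_compact_def)
  then have col: "toeplitz_column \<theta> n \<in> koethe_space b" for n
    by (simp add: toeplitz_well_defined_def)
  have T: "toeplitz_operator b \<theta> x = toeplitz_product \<theta> x" if "x \<in> koethe_space a" for x
    using wd that toeplitz_operator_eq_product[OF b] unfolding toeplitz_well_defined_def by blast
  obtain U where U: "zero_nbhd a U" "precompact_in b (toeplitz_operator b \<theta> ` U)"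
    using comp by (auto simp: toeplitz_compact_def koethe_compact_def)
  obtain m r where r: "0 < r" "koethe_ball a m (\<lambda>_. 0) r \<subseteq> U"
    using U(1) by (rule zero_nbhd_contains_ball[OF a])
  have "\<exists>C>0. \<forall>n. koethe_seminorm b k (toeplitz_column \<theta> n) \<le> C * a n m" for k
  proof -
    obtain R where R: "\<And>x. x \<in> U \<Longrightarrow> koethe_seminorm b k (toeplitz_operator b \<theta> x) \<le> R"
      using precompact_in_imp_bounded[OF b U(2)] by blast
    have scaled: "c * koethe_seminorm b k (toeplitz_column \<theta> n) \<le> R"
      if c: "0 \<le> c" "c * a n m < r" for c n
    proof -
      define x :: "nat \<Rightarrow> 'a" where "x = (\<lambda>i. if i = n then of_real c else 0)"
      have x: "x \<in> koethe_space a"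
        by (rule koethe_space_finite_support[of "Suc n"]) (simp add: x_def)
      then have "x \<in> U"
        using r(2) c koethe_seminorm_unit_vector[of a m n "of_real c :: 'a"]
        by (auto simp: koethe_ball_def x_def)
      from R[OF this] show ?thesis
        using c(1) unfolding T[OF x]
        by (simp add: x_def toeplitz_product_unit_vector koethe_space_scale(2)[OF col])
    qed
    define C where "C = 2 * (\<bar>R\<bar> + 1) / r"
    have "koethe_seminorm b k (toeplitz_column \<theta> n) \<le> C * a n m" for n
    proof (cases "a n m = 0")
      case True
      define q where "q = koethe_seminorm b k (toeplitz_column \<theta> n)"
      have q: "0 \<le> q"
        unfolding q_def by (intro koethe_seminorm_nonneg b col)
      have "q = 0"
      proof (rule ccontr)
        assume "q \<noteq> 0"
        with q have "0 < q" by simp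
        then have "(\<bar>R\<bar> + 1) / q * q \<le> R"
          using scaled[of "(\<bar>R\<bar> + 1) / q" n] True r(1) by (simp add: q_def)
        with \<open>0 < q\<close> show False by simp
      qed
      with True show ?thesis
        by (simp add: q_def)
    next
      case False
      with koethe_matrix_nonneg[OF a, of n m] have pos: "0 < a n m"
        by simp
      have "r / (2 * a n m) * koethe_seminorm b k (toeplitz_column \<theta> n) \<le> \<bar>R\<bar> + 1"
        using scaled[of "r / (2 * a n m)" n] pos r(1) by simp
      with pos r(1) show ?thesis
        by (simp add: C_def field_simps)
    qed
    moreover have "0 < C"
      using r(1) by (simp add: C_def)
    ultimately show ?thesis by blast
  qed
  then show ?thesis
    by (intro exI[of _ m] allI)
qed

section \<open>Power series spaces of finite type\<close>

lemma finite_type_matrix_pos: "0 < finite_type_matrix \<beta> n k"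
  by (simp add: finite_type_matrix_def)

lemma koethe_matrix_finite_type:
  assumes "finite_type_exponents \<beta>"
  shows "koethe_matrix (finite_type_matrix \<beta>)"
proof -
  have "\<beta> n / real (Suc (Suc k)) \<le> \<beta> n / real (Suc k)" for n k
    using assms by (intro divide_left_mono) (auto simp: finite_type_exponents_def)
  then show ?thesis
    by (auto simp: koethe_matrix_def finite_type_matrix_def)
qed

lemma finite_type_matrix_halve:
  "finite_type_matrix \<beta> n k = (finite_type_matrix \<beta> n (2 * k + 1))\<^sup>2"
proof -
  have "- (1 / real (Suc k)) * \<beta> n = 2 * (- (1 / real (Suc (2 * k + 1))) * \<beta> n)"
    by (simp add: field_simps)
  then show ?thesis
    unfolding finite_type_matrix_def by (simp only: exp_double)
qed

lemma finite_type_matrix_tendsto_0: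
  assumes "finite_type_exponents \<beta>"
  shows "(\<lambda>n. finite_type_matrix \<beta> n k) \<longlonglongrightarrow> 0"
proof -
  have "filterlim (\<lambda>n. (1 / real (Suc k)) * \<beta> n) at_top sequentially"
    using assms by (intro filterlim_tendsto_pos_mult_at_top[OF tendsto_const])
      (auto simp: finite_type_exponents_def)
  then show ?thesis
    unfolding finite_type_matrix_def
    by (auto intro!: filterlim_compose[OF exp_at_bot] simp: filterlim_uminus_at_top)
qed

lemma finite_type_schwartz:
  assumes "finite_type_exponents \<beta>"
  shows "\<exists>l. \<forall>e>0. \<forall>\<^sub>F n in sequentially. finite_type_matrix \<beta> n k \<le> e * finite_type_matrix \<beta> n l"
proof (intro exI allI impI)
  fix e :: real assume "0 < e"
  from order_tendstoD(2)[OF finite_type_matrix_tendsto_0[OF assms, of "2 * k + 1"] this]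
  show "\<forall>\<^sub>F n in sequentially. finite_type_matrix \<beta> n k \<le> e * finite_type_matrix \<beta> n (2 * k + 1)"
    by eventually_elim
      (auto simp: finite_type_matrix_halve[of \<beta> _ k] power2_eq_square
        intro!: mult_right_mono less_imp_le[OF finite_type_matrix_pos])
qed

text \<open>This is where monotonicity of \<open>\<beta>\<close> enters: half of the exponent at row
  \<open>n + t\<close> is estimated by that of row \<open>t\<close>, which keeps the series over \<open>\<theta>\<close> convergent, and the
  other half by that of row \<open>n + s\<close>, which gives the decay in \<open>n\<close>.\<close>

lemma toeplitz_column_finite_type:
  assumes \<beta>: "finite_type_exponents \<beta>" and \<theta>: "\<theta> \<in> \<Lambda>\<^sub>1 \<beta>" and s: "\<And>t. t < s \<Longrightarrow> \<theta> t = 0"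
  shows "toeplitz_column \<theta> n \<in> \<Lambda>\<^sub>1 \<beta>"
    and "koethe_seminorm (finite_type_matrix \<beta>) k (toeplitz_column \<theta> n)
      \<le> koethe_seminorm (finite_type_matrix \<beta>) (2 * k + 1) \<theta>
        * finite_type_matrix \<beta> (n + s) (2 * k + 1)"
proof -
  let ?b = "finite_type_matrix \<beta>"
  have mono: "?b j l \<le> ?b i l" if "i \<le> j" for i j l
    using \<beta> that by (auto simp: finite_type_matrix_def finite_type_exponents_def mono_def
        intro!: divide_right_mono)
  have le: "norm (\<theta> t) * ?b (t + n) k
      \<le> norm (\<theta> t) * ?b t (2 * k + 1) * ?b (n + s) (2 * k + 1)" for t k
  proof (cases "t < s")
    case False
    then have "?b (t + n) (2 * k + 1) * ?b (t + n) (2 * k + 1)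
        \<le> ?b t (2 * k + 1) * ?b (n + s) (2 * k + 1)"
      by (intro mult_mono mono less_imp_le[OF finite_type_matrix_pos]) auto
    then show ?thesis
      unfolding finite_type_matrix_halve[of \<beta> "t + n" k]
      by (simp add: power2_eq_square mult.assoc mult_left_mono)
  qed (simp add: s)
  have sm: "summable (\<lambda>t. norm (\<theta> t) * ?b t (2 * k + 1) * ?b (n + s) (2 * k + 1))" for k
    by (intro summable_mult2 koethe_space_summable \<theta>)
  have shifted: "summable (\<lambda>t. norm (\<theta> t) * ?b (t + n) k)" for k
    by (rule summable_comparison_test'[OF sm[of k]])
      (use le in \<open>simp add: less_imp_le[OF finite_type_matrix_pos]\<close>)
  have sums: "(\<lambda>j. norm (toeplitz_column \<theta> n j) * ?b j k) sums (\<Sum>t. norm (\<theta> t) * ?b (t + n) k)"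
    for k
    using summable_sums[OF shifted[of k]]
      sums_zero_iff_shift[of n "\<lambda>j. norm (toeplitz_column \<theta> n j) * ?b j k"]
    by (simp add: toeplitz_column_def)
  then show "toeplitz_column \<theta> n \<in> \<Lambda>\<^sub>1 \<beta>"
    by (auto simp: koethe_space_def sums_iff)
  have "koethe_seminorm ?b k (toeplitz_column \<theta> n) = (\<Sum>t. norm (\<theta> t) * ?b (t + n) k)"
    using sums[of k] by (simp add: koethe_seminorm_def sums_iff)
  also have "\<dots> \<le> (\<Sum>t. norm (\<theta> t) * ?b t (2 * k + 1) * ?b (n + s) (2 * k + 1))"
    by (intro suminf_le le shifted sm)
  also have "\<dots> = koethe_seminorm ?b (2 * k + 1) \<theta> * ?b (n + s) (2 * k + 1)"
    unfolding koethe_seminorm_def by (intro suminf_mult2[symmetric] koethe_space_summable \<theta>)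
  finally show "koethe_seminorm ?b k (toeplitz_column \<theta> n)
      \<le> koethe_seminorm ?b (2 * k + 1) \<theta> * ?b (n + s) (2 * k + 1)" .
qed

section \<open>Characterisation of compactness\<close>

theorem theorem3p4:
  fixes a :: "nat \<Rightarrow> nat \<Rightarrow> real"
    and \<beta> :: "nat \<Rightarrow> real"
    and \<theta> :: "nat \<Rightarrow> 'a::{real_normed_field, banach, heine_borel}"
    and s\<^sub>0 :: nat
  assumes "koethe_matrix a"
    and "finite_type_exponents \<beta>"
    and "infinite {t. \<theta> t \<noteq> 0}"
    and "s\<^sub>0 = (LEAST t. \<theta> t \<noteq> 0)"
  shows "toeplitz_compact a (finite_type_matrix \<beta>) \<theta> \<longleftrightarrow>
    \<theta> \<in> \<Lambda>\<^sub>1 \<beta> \<and>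
    (\<exists>m. \<forall>k. \<exists>C>0. \<forall>n. exp (- (1 / real (Suc k)) * \<beta> (n + s\<^sub>0)) \<le> C * a n m)"
proof -
  let ?b = "finite_type_matrix \<beta>"
  note a = assms(1) and \<beta> = assms(2)
  note b = koethe_matrix_finite_type[OF \<beta>]
  obtain t where "\<theta> t \<noteq> 0"
    using not_finite_existsD[OF assms(3)] by auto
  then have s0: "\<theta> s\<^sub>0 \<noteq> 0"
    unfolding assms(4) by (rule LeastI)
  have below: "\<theta> t = 0" if "t < s\<^sub>0" for t
    using not_less_Least[of t "\<lambda>t. \<theta> t \<noteq> 0"] that unfolding assms(4) by blast
  have "toeplitz_compact a ?b \<theta> \<longleftrightarrow>
    \<theta> \<in> \<Lambda>\<^sub>1 \<beta> \<and> (\<exists>m. \<forall>k. \<exists>C>0. \<forall>n. ?b (n + s\<^sub>0) k \<le> C * a n m)"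
  proof
    assume comp: "toeplitz_compact a ?b \<theta>"
    then have col: "toeplitz_column \<theta> n \<in> \<Lambda>\<^sub>1 \<beta>" for n
      by (simp add: toeplitz_compact_def toeplitz_well_defined_def)
    have "toeplitz_column \<theta> 0 = \<theta>"
      by (simp add: toeplitz_column_def)
    then have \<theta>: "\<theta> \<in> \<Lambda>\<^sub>1 \<beta>"
      using col[of 0] by simp
    obtain m where m: "\<And>k. \<exists>C>0. \<forall>n. koethe_seminorm ?b k (toeplitz_column \<theta> n) \<le> C * a n m"
      using compact_imp_column_bound[OF a b comp] by blast
    have "\<exists>C>0. \<forall>n. ?b (n + s\<^sub>0) k \<le> C * a n m" for k
    proof -
      obtain C where C: "C > 0" "\<And>n. koethe_seminorm ?b k (toeplitz_column \<theta> n) \<le> C * a n m"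
        using m by blast
      have "norm (\<theta> s\<^sub>0) * ?b (n + s\<^sub>0) k \<le> C * a n m" for n
        using koethe_coordinate_le[OF b col, of n "n + s\<^sub>0" k] C(2)[of n]
        by (simp add: toeplitz_column_def)
      then have "?b (n + s\<^sub>0) k \<le> C / norm (\<theta> s\<^sub>0) * a n m" for n
        using s0 by (simp add: field_simps)
      moreover have "0 < C / norm (\<theta> s\<^sub>0)"
        using C(1) s0 by simp
      ultimately show ?thesis by blast
    qed
    with \<theta> show "\<theta> \<in> \<Lambda>\<^sub>1 \<beta> \<and> (\<exists>m. \<forall>k. \<exists>C>0. \<forall>n. ?b (n + s\<^sub>0) k \<le> C * a n m)"
      by (intro conjI exI[of _ m] allI)
  next
    assume "\<theta> \<in> \<Lambda>\<^sub>1 \<beta> \<and> (\<exists>m. \<forall>k. \<exists>C>0. \<forall>n. ?b (n + s\<^sub>0) k \<le> C * a n m)"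
    then obtain m where \<theta>: "\<theta> \<in> \<Lambda>\<^sub>1 \<beta>"
      and "\<forall>k. \<exists>C>0. \<forall>n. ?b (n + s\<^sub>0) k \<le> C * a n m"
      by blast
    then obtain D where D: "\<And>k. D k > 0" "\<And>n k. ?b (n + s\<^sub>0) k \<le> D k * a n m"
      by metis
    note column = toeplitz_column_finite_type[OF \<beta> \<theta> below]
    define C where "C k = koethe_seminorm ?b (2 * k + 1) \<theta> * D (2 * k + 1)" for k
    have nonneg: "0 \<le> koethe_seminorm ?b l \<theta>" for l
      by (intro koethe_seminorm_nonneg b \<theta>)
    show "toeplitz_compact a ?b \<theta>"
    proof (rule column_bound_imp_compact[OF a b finite_type_schwartz[OF \<beta>] column(1)])
      show "0 \<le> C k" for k
        unfolding C_def using nonneg D(1) by (simp add: less_imp_le)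
      show "koethe_seminorm ?b k (toeplitz_column \<theta> n) \<le> C k * a n m" for n k
      proof -
        have "koethe_seminorm ?b k (toeplitz_column \<theta> n)
            \<le> koethe_seminorm ?b (2 * k + 1) \<theta> * ?b (n + s\<^sub>0) (2 * k + 1)"
          by (rule column(2))
        also have "\<dots> \<le> koethe_seminorm ?b (2 * k + 1) \<theta> * (D (2 * k + 1) * a n m)"
          by (intro mult_left_mono D nonneg)
        finally show ?thesis
          by (simp add: C_def mult.assoc)
      qed
    qed
  qed
  then show ?thesis
    unfolding finite_type_matrix_def .
qed

end
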